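(* Let $\Delta$ be a specification such that every pseudo-type assigned by $\Delta$ to a participant's session in $\mathrm{dom}\,\Delta$ is in normal form, and let $\vec y$ be a tuple of pairwise distinct session channels. If $\Delta\xrightarrow{\tau}\Delta'$, then for all $r\in\mathcal R_{\vec y}(\Delta')$ either: $r\in\mathcal R_{\vec y}(\Delta)$; or $\langle p,\bar y\,d\rangle r\in\mathcal R_{\vec y}(\Delta)$ for some $p,y,d$; or else $\langle q,y\,d\rangle r\in\mathcal R_{\vec y}(\Delta)$ for some $q,y,d$.
   Context: **Names.** Fix pairwise disjoint infinite sets of shared names $\mathbb U\ni u$, session channels $\mathbb Y\ni y$, participants $\mathbb P\ni p,q$ (identified with the natural numbers), and variables. Sorts $d$ are basic data types. $\vec y$ is a tuple of pairwise distinct session channels, also viewed as a set. Guards $e$ are Boolean expressions built from variables, values, unary and binary operators. **Global types.** Global type terms: $G::=\sum_{i\in I}p\to q_i:y_i\,d_i;G_i\mid G;G'\mid G^{*f}\mid\mathsf{end}$, $I\neq\emptyset$ finite, $p\ne q_i$, and $y_i\neq y_j$ whenever $q_i=q_j$, $i\neq j$; $f$ is an injective partial map from participants to sorted channels $y\,d$ and $\mathrm{ch}(f)$ is the set of channels in its image. $\mathcal P(G)$ is the set of participants occurring in interactions of $G$; $\mathrm{ch}(G)$ the set of channels occurring in $G$ (including those of the maps $f$). $\mathrm{rdy}(\sum_i p\to q_i\cdots)=\{p\}$, $\mathrm{rdy}(G;G')=\mathrm{rdy}(G)$ if nonempty and $\mathrm{rdy}(G')$ otherwise, $\mathrm{rdy}(G^{*f})=\mathrm{rdy}(G)$,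 $\mathrm{rdy}(\mathsf{end})=\emptyset$. A global type is an equation $\mathcal G(\vec y)\triangleq G$ with $\mathrm{ch}(G)\subseteq\vec y$; $\equiv$ is equality up to: $;$ and $+$ are monoids with unit $\mathsf{end}$, $+$ is commutative, and renaming of the parameters $\vec y$. All global types are assumed well-formed: (i) knowledge of choice: in every choice with selector $p$, every other participant involved can determine the chosen branch from the messages it receives (it occurs in every branch, its first interaction in each branch is a reception, and the channels of these receptions differ across branches); (ii) linearity: any two interactions on the same channel are causally related (no races); (iii) for each iteration $G^{*f}$ occurring: $\mathrm{ch}(f)\cap\mathrm{ch}(G)=\emptyset$, $\mathrm{rdy}(G)$ is a singleton, $\mathrm{dom}f=\mathcal P(G)\setminus\mathrm{rdy}(G)$, and $\mathrm{ch}(f_1)\cap\mathrm{ch}(f)=\emptyset$ for each proper subterm $G_1^{*f_1}$ of $G$. **Local types and projection.** $T::=\bigoplus_{i\in I}\bar y_i\,d_i.T_i\mid\sum_{i\in I}y_i\,d_i.T_i\mid T_1;T_2\mid T^*\mid\mathsf{end}$ (internal/external choice over pairwise distinct channels, $I\ne\emptyset$), up to: choices associative, commutative, with unit $\mathsf{end}$; $;$ associative with unit $\mathsf{end}$. Projection: $G{\upharpoonright}r=\mathsf{end}$ if $r\notin\mathcal P(G)$; otherwise $(\sum_{i\in I}r\to q_i:y_i\,d_i;G_i){\upharpoonright}r=\bigoplus_{i\in I}\bar y_i\,d_i.(G_i{\upharpoonright}r)$; for $r\ne p$, $(\sum_{i\in I}p\to q_i:y_i\,d_i;G_i){\upharpoonright}r=\sum_{i\in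 I_r}y_i\,d_i.(G_i{\upharpoonright}r)+\sum_{i\in I\setminus I_r}G_i{\upharpoonright}r$ with $I_r=\{i:q_i=r\}$; $(G_1;G_2){\upharpoonright}r=G_1{\upharpoonright}r;G_2{\upharpoonright}r$; $G_1^{*f}{\upharpoonright}r=(G_1{\upharpoonright}r)^*;\bar b_1\,d_1;\dots;\bar b_n\,d_n$ if $r\in\mathrm{rdy}(G_1)$ and the image of $f$ is $\{b_1\,d_1,\dots,b_n\,d_n\}$; $G_1^{*f}{\upharpoonright}r=(G_1{\upharpoonright}r)^*;b\,d$ if $f(r)=b\,d$. For $\mathcal G(\vec y)\triangleq G$, $\mathcal G(\vec y){\upharpoonright}r$ is $G{\upharpoonright}r$. **Pseudo-types.** $\mathbb T::=\bigoplus_{i\in I}e_i\triangleleft\bar y_i\,d_i.\mathbb T_i\mid\sum_{i\in I}e_i\triangleleft y_i\,d_i.\mathbb T_i\mid\mathbb T_1;\mathbb T_2\mid\mathbb T^*\mid e\triangleleft\mathsf{end}$, with guards $e_i,e$; local types are pseudo-types with all guards true. Normal form: $\mathrm{nf}(\mathbb T)=\mathrm{nf}(\mathrm{true},\mathbb T)$ where, with $J=\{i\in I:(e\wedge e_i)\Leftrightarrow\mathrm{false}\}$: (1) $\mathrm{nf}(e,e'\triangleleft\mathsf{end})=(e\wedge e')\triangleleft\mathsf{end}$; (2) $\mathrm{nf}(e,\bigoplus_{i\in I}e_i\triangleleft\bar y_i\,d_i.\mathbb T_i)$ is $\mathrm{false}\triangleleft\mathsf{end}$ if $I=J$ and else $\bigoplus_{i\in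 I\setminus J}(e_i\wedge e)\triangleleft\bar y_i\,d_i.\mathrm{nf}(e_i\wedge e,\mathbb T_i)$; (3) the same for $\sum$; (4) $\mathrm{nf}(e,e'\triangleleft\mathsf{end};\mathbb T)=\mathrm{nf}(e\wedge e',\mathbb T)$; (5) $\mathrm{nf}(e,(\bigoplus_i e_i\triangleleft\bar y_i\,d_i.\mathbb T_i);\mathbb T)=\mathrm{nf}(e,\bigoplus_i e_i\triangleleft\bar y_i\,d_i.(\mathbb T_i;\mathbb T))$; (6) the same for $\sum$; (7) $\mathrm{nf}(e,(\mathbb T;\mathbb T');\mathbb T'')=\mathrm{nf}(e,\mathbb T;(\mathbb T';\mathbb T''))$; (8) $\mathrm{nf}(e,\mathbb T^*;\mathbb T')$ is $e'\triangleleft\mathsf{end}$ if $\mathrm{nf}(e,\mathbb T)=e'\triangleleft\mathsf{end}$ and else $\mathrm{nf}(e,\mathbb T^* );\mathrm{nf}(e,\mathbb T')$; (9) $\mathrm{nf}(e,\mathbb T^* )$ is $e'\triangleleft\mathsf{end}$ if $\mathrm{nf}(e,\mathbb T)=e'\triangleleft\mathsf{end}$ and else $(\mathrm{nf}(e,\mathbb T))^*$. Mergeability of pseudo-types in normal form: two types $g\triangleleft\mathsf{end}$, $g'\triangleleft\mathsf{end}$; two external choices $\sum_{i\in I}e_i\triangleleft y_i\,d_i.\mathbb T_i$, $\sum_{i\in I}e'_i\triangleleft y_i\,d_i.\mathbb T'_i$ with, for all $i\in I$, $\mathbb T_i,\mathbb T_i'$ mergeable and $e_i\wedge e_i'\Leftrightarrow\mathrm{false}$;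 two internal choices $\bigoplus_{i\in I\cup J}e_i\triangleleft\bar y_i\,d_i.\mathbb T_i$, $\bigoplus_{i\in I\cup K}e'_i\triangleleft\bar y_i\,d_i.\mathbb T'_i$ with $I\cap J=I\cap K=\emptyset$, the channel sets $\{y_i\}_{i\in I},\{y_j\}_{j\in J},\{y_k\}_{k\in K}$ pairwise disjoint and, for all $i\in I$, $\mathbb T_i,\mathbb T'_i$ mergeable and $e_i\wedge e'_i\Leftrightarrow\mathrm{false}$; $\mathbb T_1';\mathbb T_1''$ and $\mathbb T_2';\mathbb T_2''$ with componentwise mergeable parts; $\mathbb T_1^*$ and $\mathbb T_2^*$ with $\mathbb T_1,\mathbb T_2$ mergeable. Merge $\bowtie$ of mergeable types: $(g\triangleleft\mathsf{end})\bowtie(g'\triangleleft\mathsf{end})=(g\vee g')\triangleleft\mathsf{end}$; external choices: $\sum_{i\in I}(e_i\vee e'_i)\triangleleft y_i\,d_i.(\mathbb T_i\bowtie\mathbb T'_i)$; internal choices: the internal choice over the disjoint union of the branches; componentwise on $;$ and under $*$. Guard erasure: $\mathrm{er}(e\triangleleft\mathsf{end})=\mathsf{end}$, $\mathrm{er}(\mathbb T;\mathbb T')=\mathrm{er}(\mathbb T);\mathrm{er}(\mathbb T')$, $\mathrm{er}(\mathbb T^* )=\mathrm{er}(\mathbb T)^*$, $\mathrm{er}(\sum_{i\in I}e_i\triangleleft y_i\,d_i.\mathbb T_i)=\sum_{a\in I/\sim}y_a\,d_a.\mathrm{er}(\bowtie_{i\in a}\mathbb T_i)$, and likewise for $\bigoplus$,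 where $i\sim j$ iff $y_i=y_j$. **Specifications.** A specification $\Delta$ is a finite partial map sending shared names to global types, participants' sessions $(\vec y,p)$ to pseudo-types with channels in $\vec y$, and session channels $y$ to queue types $[\vec d]$; tuples of two participants' sessions in $\mathrm{dom}\,\Delta$ are equal or disjoint. A comma denotes extension with disjoint domains; $\vec y:[\,]$ assigns the empty queue to each channel of $\vec y$. $\Delta$ is end-only if each $\mathrm{nf}(\Delta(\vec y,q))$ has the form $e\triangleleft\mathsf{end}$. $\Delta_1;\Delta_2$ (defined if $\mathrm{dom}\,\Delta_2\subseteq\mathrm{dom}\,\Delta_1$ and $\Delta_1|_{\mathbb U\cup\mathbb Y}=\Delta_2|_{\mathbb U\cup\mathbb Y}$) agrees with $\Delta_1$ on $\mathbb U\cup\mathbb Y$ and maps $(\vec y,p)$ to $\Delta_1(\vec y,p);\Delta_2(\vec y,p)$ if $(\vec y,p)\in\mathrm{dom}\,\Delta_2$ and to $\Delta_1(\vec y,p)$ otherwise; $\Delta^*$ agrees with $\Delta$ on $\mathbb U\cup\mathbb Y$ and maps $(\vec y,p)$ to $(\Delta(\vec y,p))^*$. **Transitions of specifications** (pseudo-types are normalised before and after transitions): TReq: if $\Delta(u)\equiv\mathcal G(\vec y)$ and $\mathrm{er}(\mathbb T)=\mathrm{nf}(\mathcal G(\vec y){\upharpoonright}0)$ then $\Delta\xrightarrow{\bar u^n(\vec y)}\Delta,(\vec y,0):\mathbb T$; TAcc: similarly $\Delta\xrightarrow{u^p(\vec y)}\Delta,(\vec y,p):\mathbb T$ with projection on $p$;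 TRcv: $\Delta,(\vec y,p):\sum_{i\in I}e_i\triangleleft y_i\,d_i.\mathbb T_i\xrightarrow{y_j\,d_j}\Delta,(\vec y,p):\mathbb T_j$ and TSend: $\Delta,(\vec y,p):\bigoplus_{i\in I}e_i\triangleleft\bar y_i\,d_i.\mathbb T_i\xrightarrow{\bar y_j\,d_j}\Delta,(\vec y,p):\mathbb T_j$, $j\in I$; TSeq: $\Delta_1\xrightarrow{\alpha}\Delta_1'$ implies $\Delta_1;\Delta_2\xrightarrow{\alpha}\Delta_1';\Delta_2$; TLoop$_0$: $\Delta_2\xrightarrow{y\,d}\Delta_2'$ implies $\Delta_1^*;\Delta_2\xrightarrow{y\,d}\Delta_2'$; TLoop$_1$, TLoop$_2$: $\Delta\xrightarrow{\alpha}\Delta'$ implies $\Delta^*\xrightarrow{\alpha}\Delta'$ and $\Delta^*\xrightarrow{\alpha}\Delta';\Delta^*$; TInit: if $\Delta(u)\equiv\mathcal G(\vec y)\triangleq G$, $\mathcal P(G)=\{p_0,\dots,p_n\}$, $\mathrm{er}(\mathbb T_i)=\mathrm{nf}(G{\upharpoonright}p_i)$ for all $i$, then $\Delta\xrightarrow{\tau}\Delta,(\vec y,p_0):\mathbb T_0,\dots,(\vec y,p_n):\mathbb T_n,\vec y:[\,]$; TCom$_1$: $\Delta,(\vec y,p):\bigoplus_{i\in I}e_i\triangleleft\bar y_i\,d_i.\mathbb T_i,y_j:[\vec d]\xrightarrow{\tau}\Delta,(\vec y,p):\mathbb T_j,y_j:[\vec d\cdot d_j]$; TCom$_2$: $\Delta,(\vec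 y,p):\sum_{i\in I}e_i\triangleleft y_i\,d_i.\mathbb T_i,y_j:[d_j\cdot\vec d]\xrightarrow{\tau}\Delta,(\vec y,p):\mathbb T_j,y_j:[\vec d]$, $j\in I$. **Runs of a specification.** Events are $\langle p,\bar y\,d\rangle$ (output) and $\langle p,y\,d\rangle$ (input). Annotated traces are finite sequences of events and optional subtraces $[r]$; $\epsilon$ is the empty one. A trace denotes its equivalence class under permutation of causally independent events (events of different participants on different channels). $\mathcal R_{\vec y}(\Delta)$, the set of runs of session $\vec y$ generated by $\Delta$, is given by (least sets, types in normal form): RTEnd: $\epsilon\in\mathcal R_{\vec y}(\Delta,\vec y:[\,])$ if $\Delta$ is end-only; RTCom$_1$: $\langle p,\bar y_j\,d_j\rangle r\in\mathcal R_{\vec y}(\Delta,(\vec y,p):\bigoplus_{i\in I}e_i\triangleleft\bar y_i\,d_i.\mathbb T_i,\,y_j:[\vec d])$ if $j\in I$ and $r\in\mathcal R_{\vec y}(\Delta,(\vec y,p):\mathbb T_j,\,y_j:[\vec d\cdot d_j])$; RTCom$_2$: $\langle p,y_j\,d_j\rangle r\in\mathcal R_{\vec y}(\Delta,(\vec y,p):\sum_{i\in I}e_i\triangleleft y_i\,d_i.\mathbb T_i,\,y_j:[d_j\cdot\vec d])$ if $j\in I$ and $r\in\mathcal R_{\vec y}(\Delta,(\vec y,p):\mathbb T_j,\,y_j:[\vec d])$; RTIt$_1$: $r\in\mathcal R_{\vec y}(\Delta^* )$ if $r\in\mathcal R_{\vec y}(\Delta)$; RTIt$_2$: $r_1[r_2]\in\mathcal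 R_{\vec y}(\Delta^* )$ if $r_1\in\mathcal R_{\vec y}(\Delta)$, $r_2\in\mathcal R_{\vec y}(\Delta^* )$; RTSeq: $r_1r_2\in\mathcal R_{\vec y}(\Delta_1;\Delta_2)$ if $r_i\in\mathcal R_{\vec y}(\Delta_i)$.
   Formalization: The formal theorem also assumes that the session y is running in Δ (its queues exist there, and y is equal to or disjoint from every session tuple of Δ), since otherwise initiating y refutes the claim; runs of y are computed from the entries and queues of session y only. *)

theory Defs
  imports Main "HOL-Library.Multiset"
begin

section \<open>Names, values and guards\<close>

datatype sname = SName nat
datatype chan = Chan nat
datatype vname = VName nat
type_synonym participant = nat

text \<open>
  The basic data types (sorts) are the type parameter \<open>'d\<close> of the definitions below; \<open>'b\<close>
  is the type of the non-Boolean values.  Operators are arbitrary functions on values.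
\<close>

datatype 'b val = BoolV bool | BaseV 'b

datatype 'b gexp =
    GVar vname
  | GVal "'b val"
  | GUn "'b val \<Rightarrow> 'b val" "'b gexp"
  | GBin "'b val \<Rightarrow> 'b val \<Rightarrow> 'b val" "'b gexp" "'b gexp"

primrec geval :: "(vname \<Rightarrow> 'b val) \<Rightarrow> 'b gexp \<Rightarrow> 'b val" where
  "geval s (GVar x) = s x"
| "geval s (GVal v) = v"
| "geval s (GUn f e) = f (geval s e)"
| "geval s (GBin f e e') = f (geval s e) (geval s e')"

definition gholds :: "(vname \<Rightarrow> 'b val) \<Rightarrow> 'b gexp \<Rightarrow> bool" where
  "gholds s e \<longleftrightarrow> geval s e = BoolV True"

definition andV :: "'b val \<Rightarrow> 'b val \<Rightarrow> 'b val" where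
  "andV v w = BoolV (v = BoolV True \<and> w = BoolV True)"

definition orV :: "'b val \<Rightarrow> 'b val \<Rightarrow> 'b val" where
  "orV v w = BoolV (v = BoolV True \<or> w = BoolV True)"

text \<open>
  Logical equivalence of guards.  Normal forms, erasures and mergeability are only meaningful up
  to this equivalence, so a guard is an expression modulo logical equivalence; in
  particular, equality of guards is \<open>\<Leftrightarrow>\<close>.
\<close>

definition gequiv :: "'b gexp \<Rightarrow> 'b gexp \<Rightarrow> bool" where
  "gequiv e e' \<longleftrightarrow> (\<forall>s. gholds s e \<longleftrightarrow> gholds s e')"

quotient_type 'b guard = "'b gexp" / gequiv
  by (rule equivpI) (auto simp: reflp_def symp_def transp_def gequiv_def)

lift_definition gtrue :: "'b guard" is "GVal (BoolV True)" .
lift_definition gfalse :: "'b guard" is "GVal (BoolV False)" .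
lift_definition gand :: "'b guard \<Rightarrow> 'b guard \<Rightarrow> 'b guard" (infixr "\<and>\<^sub>g" 65) is "GBin andV"
  by (simp add: gequiv_def gholds_def andV_def)
lift_definition gor :: "'b guard \<Rightarrow> 'b guard \<Rightarrow> 'b guard" (infixr "\<or>\<^sub>g" 60) is "GBin orV"
  by (simp add: gequiv_def gholds_def orV_def)


section \<open>Global types\<close>

text \<open>\<open>GChoice p bs\<close> is the choice with selector \<open>p\<close>; the index set is the set of list positions.\<close>

datatype 'd gty =
    GChoice participant "'d gbranch list"
  | GSeq "'d gty" "'d gty"
  | GIter "'d gty" "participant \<rightharpoonup> chan \<times> 'd"
  | GEnd
and 'd gbranch = GBr (grecv: participant) (gchan: chan) (gsort: 'd) (gcont: "'d gty")

lemma size_gcont [termination_simp]: "b \<in> set bs \<Longrightarrow> size (gcont b) < Suc (size_list size bs)"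
proof (induction bs)
  case (Cons c bs)
  then show ?case by (cases c) auto
qed simp

definition chs :: "(participant \<rightharpoonup> chan \<times> 'd) \<Rightarrow> chan set" where
  "chs f = fst ` ran f"

fun gparts :: "'d gty \<Rightarrow> participant set" where
  "gparts (GChoice p bs) = (\<Union>b\<in>set bs. {p, grecv b} \<union> gparts (gcont b))"
| "gparts (GSeq G G') = gparts G \<union> gparts G'"
| "gparts (GIter G f) = gparts G"
| "gparts GEnd = {}"

fun gchans :: "'d gty \<Rightarrow> chan set" where
  "gchans (GChoice p bs) = (\<Union>b\<in>set bs. {gchan b} \<union> gchans (gcont b))"
| "gchans (GSeq G G') = gchans G \<union> gchans G'"
| "gchans (GIter G f) = gchans G \<union> chs f"
| "gchans GEnd = {}"

fun rdy :: "'d gty \<Rightarrow> participant set" where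
  "rdy (GChoice p bs) = {p}"
| "rdy (GSeq G G') = (if rdy G \<noteq> {} then rdy G else rdy G')"
| "rdy (GIter G f) = rdy G"
| "rdy GEnd = {}"

fun gsubterms :: "'d gty \<Rightarrow> 'd gty set" where
  "gsubterms (GChoice p bs) = insert (GChoice p bs) (\<Union>b\<in>set bs. gsubterms (gcont b))"
| "gsubterms (GSeq G G') = insert (GSeq G G') (gsubterms G \<union> gsubterms G')"
| "gsubterms (GIter G f) = insert (GIter G f) (gsubterms G)"
| "gsubterms GEnd = {GEnd}"

fun grename :: "(chan \<Rightarrow> chan) \<Rightarrow> 'd gty \<Rightarrow> 'd gty" where
  "grename h (GChoice p bs) =
     GChoice p (map (\<lambda>b. GBr (grecv b) (h (gchan b)) (gsort b) (grename h (gcont b))) bs)"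
| "grename h (GSeq G G') = GSeq (grename h G) (grename h G')"
| "grename h (GIter G f) = GIter (grename h G) (\<lambda>p. map_option (map_prod h id) (f p))"
| "grename h GEnd = GEnd"

inductive geq :: "'d gty \<Rightarrow> 'd gty \<Rightarrow> bool" where
  geq_refl: "geq G G"
| geq_sym: "geq G G' \<Longrightarrow> geq G' G"
| geq_trans: "geq G G' \<Longrightarrow> geq G' G'' \<Longrightarrow> geq G G''"
| geq_assoc: "geq (GSeq (GSeq G G') G'') (GSeq G (GSeq G' G''))"
| geq_unitL: "geq (GSeq GEnd G) G"
| geq_unitR: "geq (GSeq G GEnd) G"
| geq_comm: "mset bs = mset bs' \<Longrightarrow> geq (GChoice p bs) (GChoice p bs')"
| geq_branch: "geq G G' \<Longrightarrow>
    geq (GChoice p (bs @ GBr q y d G # bs')) (GChoice p (bs @ GBr q y d G' # bs'))"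
| geq_seq: "geq G1 G1' \<Longrightarrow> geq G2 G2' \<Longrightarrow> geq (GSeq G1 G2) (GSeq G1' G2')"
| geq_iter: "geq G G' \<Longrightarrow> geq (GIter G f) (GIter G' f)"

text \<open>The pair \<open>(ys, G)\<close> stands for the equation with parameters \<open>ys\<close> and body \<open>G\<close>.\<close>

type_synonym 'd gdecl = "chan list \<times> 'd gty"

definition gdecl_eq :: "'d gdecl \<Rightarrow> 'd gdecl \<Rightarrow> bool" where
  "gdecl_eq D D' \<longleftrightarrow> distinct (fst D) \<and> distinct (fst D') \<and>
     (\<exists>h. map h (fst D) = fst D' \<and> geq (grename h (snd D)) (snd D'))"


subsection \<open>Well-formedness\<close>

definition gsyntax :: "'d gty \<Rightarrow> bool" where
  "gsyntax G \<longleftrightarrow>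
     (\<forall>p bs. GChoice p bs \<in> gsubterms G \<longrightarrow>
        bs \<noteq> [] \<and> (\<forall>b\<in>set bs. p \<noteq> grecv b) \<and>
        (\<forall>i<length bs. \<forall>j<length bs.
           i \<noteq> j \<and> grecv (bs ! i) = grecv (bs ! j) \<longrightarrow> gchan (bs ! i) \<noteq> gchan (bs ! j))) \<and>
     (\<forall>G' f. GIter G' f \<in> gsubterms G \<longrightarrow> inj_on f (dom f))"

datatype polarity = Snd | Rcv

text \<open>
  The possible first actions of participant \<open>r\<close>.  An iteration may be left at once, so the
  termination signals carried by \<open>f\<close> are possible first actions, too.
\<close>

fun gfirst :: "participant \<Rightarrow> 'd gty \<Rightarrow> (polarity \<times> chan) set" where
  "gfirst r (GChoice p bs) =
     (\<Union>b\<in>set bs. if r = p then {(Snd, gchan b)}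
                 else if r = grecv b then {(Rcv, gchan b)}
                 else gfirst r (gcont b))"
| "gfirst r (GSeq G G') = (if r \<in> gparts G then gfirst r G else gfirst r G')"
| "gfirst r (GIter G f) =
     (if r \<notin> gparts G then {}
      else gfirst r G \<union>
        (if r \<in> rdy G then {(Snd, y) | y. y \<in> chs f}
         else {(Rcv, y) | y d. f r = Some (y, d)}))"
| "gfirst r GEnd = {}"

text \<open>A one-branch choice is a plain interaction prefix: there is no choice to be known.\<close>

definition knowledge_of_choice :: "'d gty \<Rightarrow> bool" where
  "knowledge_of_choice G \<longleftrightarrow>
     (\<forall>p bs. GChoice p bs \<in> gsubterms G \<and> length bs \<ge> 2 \<longrightarrow>
        (\<forall>r \<in> gparts (GChoice p bs) - {p}.
           (\<forall>b\<in>set bs. r \<in> gparts (GChoice p [b]) \<and>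
              (\<forall>a\<in>gfirst r (GChoice p [b]). fst a = Rcv)) \<and>
           (\<forall>i<length bs. \<forall>j<length bs. i \<noteq> j \<longrightarrow>
              snd ` gfirst r (GChoice p [bs ! i]) \<inter> snd ` gfirst r (GChoice p [bs ! j]) = {})))"

text \<open>
  \<open>gpath G w\<close>: \<open>w\<close> lists the interactions \<open>(sender, receiver, channel)\<close> met along one way of
  resolving all choices and unfolding all iterations of \<open>G\<close>.  Interactions in different branches of
  a choice never occur together and hence cannot race.
\<close>

type_synonym interaction = "participant \<times> participant \<times> chan"

inductive gpath :: "'d gty \<Rightarrow> interaction list \<Rightarrow> bool" where
  "gpath GEnd []"
| "b \<in> set bs \<Longrightarrow> gpath (gcont b) w \<Longrightarrow> gpath (GChoice p bs) ((p, grecv b, gchan b) # w)"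
| "gpath G w \<Longrightarrow> gpath G' w' \<Longrightarrow> gpath (GSeq G G') (w @ w')"
| "rdy G = {p} \<Longrightarrow> distinct rs \<Longrightarrow> set rs = dom f \<Longrightarrow>
     gpath (GIter G f) (map (\<lambda>r. (p, r, fst (the (f r)))) rs)"
| "gpath G w \<Longrightarrow> gpath (GIter G f) w' \<Longrightarrow> gpath (GIter G f) (w @ w')"

text \<open>
  Causality between the output and input events of a path: program order of each participant, and
  the output of a message before its input.
\<close>

definition actor :: "interaction list \<Rightarrow> nat \<times> polarity \<Rightarrow> participant" where
  "actor w a = (case snd a of Snd \<Rightarrow> fst (w ! fst a) | Rcv \<Rightarrow> fst (snd (w ! fst a)))"

definition causality :: "interaction list \<Rightarrow> ((nat \<times> polarity) \<times> (nat \<times> polarity)) set" where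
  "causality w =
     ({((i, Snd), (i, Rcv)) | i. i < length w} \<union>
      {((i, a), (j, b)) | i a j b. i < j \<and> j < length w \<and> actor w (i, a) = actor w (j, b)})\<^sup>+"

definition linear :: "'d gty \<Rightarrow> bool" where
  "linear G \<longleftrightarrow>
     (\<forall>w i j. gpath G w \<and> i < j \<and> j < length w \<and> snd (snd (w ! i)) = snd (snd (w ! j)) \<longrightarrow>
        ((i, Snd), (j, Snd)) \<in> causality w \<and> ((i, Rcv), (j, Rcv)) \<in> causality w)"

definition iterations_ok :: "'d gty \<Rightarrow> bool" where
  "iterations_ok G \<longleftrightarrow>
     (\<forall>G' f. GIter G' f \<in> gsubterms G \<longrightarrow>
        chs f \<inter> gchans G' = {} \<and>
        (\<exists>p. rdy G' = {p}) \<and>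
        dom f = gparts G' - rdy G' \<and>
        (\<forall>G1 f1. GIter G1 f1 \<in> gsubterms G' - {G'} \<longrightarrow> chs f1 \<inter> chs f = {}))"

definition gdecl_wf :: "'d gdecl \<Rightarrow> bool" where
  "gdecl_wf D \<longleftrightarrow>
     distinct (fst D) \<and> gchans (snd D) \<subseteq> set (fst D) \<and> gsyntax (snd D) \<and>
     knowledge_of_choice (snd D) \<and> linear (snd D) \<and> iterations_ok (snd D)"


section \<open>Pseudo-types and local types\<close>

text \<open>
  \<open>PInt\<close> is internal choice (outputs), \<open>PExt\<close> external choice (inputs).  Local types are the
  pseudo-types whose guards are all \<open>gtrue\<close>.
\<close>

datatype ('b, 'd) pty =
    PInt "('b, 'd) pbranch list"
  | PExt "('b, 'd) pbranch list"
  | PSeq "('b, 'd) pty" "('b, 'd) pty"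
  | PStar "('b, 'd) pty"
  | PEnd "'b guard"
and ('b, 'd) pbranch = Br (bguard: "'b guard") (bchan: chan) (bsort: 'd) (bcont: "('b, 'd) pty")

lemma size_bcont [termination_simp]: "b \<in> set bs \<Longrightarrow> size (bcont b) < Suc (size_list size bs)"
proof (induction bs)
  case (Cons c bs)
  then show ?case by (cases c) auto
qed simp

abbreviation bchans :: "('b, 'd) pbranch list \<Rightarrow> chan set" where
  "bchans bs \<equiv> bchan ` set bs"

fun pchans :: "('b, 'd) pty \<Rightarrow> chan set" where
  "pchans (PInt bs) = (\<Union>b\<in>set bs. {bchan b} \<union> pchans (bcont b))"
| "pchans (PExt bs) = (\<Union>b\<in>set bs. {bchan b} \<union> pchans (bcont b))"
| "pchans (PSeq T T') = pchans T \<union> pchans T'"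
| "pchans (PStar T) = pchans T"
| "pchans (PEnd e) = {}"

fun psyntax :: "('b, 'd) pty \<Rightarrow> bool" where
  "psyntax (PInt bs) \<longleftrightarrow> bs \<noteq> [] \<and> (\<forall>b\<in>set bs. psyntax (bcont b))"
| "psyntax (PExt bs) \<longleftrightarrow> bs \<noteq> [] \<and> (\<forall>b\<in>set bs. psyntax (bcont b))"
| "psyntax (PSeq T T') \<longleftrightarrow> psyntax T \<and> psyntax T'"
| "psyntax (PStar T) \<longleftrightarrow> psyntax T"
| "psyntax (PEnd e) \<longleftrightarrow> True"

text \<open>Equality of local types (in n-ary choices, associativity and unit of choice are built in).\<close>

inductive leq :: "('b, 'd) pty \<Rightarrow> ('b, 'd) pty \<Rightarrow> bool" where
  leq_refl: "leq T T"
| leq_sym: "leq T T' \<Longrightarrow> leq T' T"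
| leq_trans: "leq T T' \<Longrightarrow> leq T' T'' \<Longrightarrow> leq T T''"
| leq_assoc: "leq (PSeq (PSeq T T') T'') (PSeq T (PSeq T' T''))"
| leq_unitL: "leq (PSeq (PEnd gtrue) T) T"
| leq_unitR: "leq (PSeq T (PEnd gtrue)) T"
| leq_int_comm: "mset bs = mset bs' \<Longrightarrow> leq (PInt bs) (PInt bs')"
| leq_ext_comm: "mset bs = mset bs' \<Longrightarrow> leq (PExt bs) (PExt bs')"
| leq_int: "leq T T' \<Longrightarrow> leq (PInt (bs @ Br e y d T # bs')) (PInt (bs @ Br e y d T' # bs'))"
| leq_ext: "leq T T' \<Longrightarrow> leq (PExt (bs @ Br e y d T # bs')) (PExt (bs @ Br e y d T' # bs'))"
| leq_seq: "leq T1 T1' \<Longrightarrow> leq T2 T2' \<Longrightarrow> leq (PSeq T1 T2) (PSeq T1' T2')"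
| leq_star: "leq T T' \<Longrightarrow> leq (PStar T) (PStar T')"


subsection \<open>Normal forms\<close>

primrec weight :: "('b, 'd) pty \<Rightarrow> nat" and weight_br :: "('b, 'd) pbranch \<Rightarrow> nat" where
  "weight (PInt bs) = 1 + sum_list (map weight_br bs)"
| "weight (PExt bs) = 1 + sum_list (map weight_br bs)"
| "weight (PSeq T T') = weight T * (1 + weight T')"
| "weight (PStar T) = 1 + weight T"
| "weight (PEnd e) = 1"
| "weight_br (Br e y d T) = weight T"

lemma weight_pos: "weight T > 0"
  by (induction T rule: pty.induct[where ?P2.0 = "\<lambda>_. True"]) auto

lemma weight_br_eq: "weight_br b = weight (bcont b)"
  by (cases b) simp

lemma weight_branch: "b \<in> set bs \<Longrightarrow> weight (bcont b) < Suc (sum_list (map weight_br bs))"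
  by (induction bs) (auto simp: weight_br_eq)

lemma weight_distrib:
  "sum_list (map (\<lambda>b. weight (bcont b) * Suc k) bs) = sum_list (map weight_br bs) * Suc k"
  by (induction bs) (auto simp: weight_br_eq algebra_simps)

lemma weight_star: "weight T < weight T' + weight T * Suc (weight T')"
  using weight_pos[of T'] by (simp add: trans_less_add1)

function nf_under :: "'b guard \<Rightarrow> ('b, 'd) pty \<Rightarrow> ('b, 'd) pty" where
  "nf_under e (PEnd e') = PEnd (e \<and>\<^sub>g e')"
| "nf_under e (PInt bs) =
     (let bs' = filter (\<lambda>b. e \<and>\<^sub>g bguard b \<noteq> gfalse) bs in
      if bs' = [] then PEnd gfalse
      else PInt (map (\<lambda>b. Br (bguard b \<and>\<^sub>g e) (bchan b) (bsort b)
                             (nf_under (bguard b \<and>\<^sub>g e) (bcont b))) bs'))"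
| "nf_under e (PExt bs) =
     (let bs' = filter (\<lambda>b. e \<and>\<^sub>g bguard b \<noteq> gfalse) bs in
      if bs' = [] then PEnd gfalse
      else PExt (map (\<lambda>b. Br (bguard b \<and>\<^sub>g e) (bchan b) (bsort b)
                             (nf_under (bguard b \<and>\<^sub>g e) (bcont b))) bs'))"
| "nf_under e (PSeq (PEnd e') T) = nf_under (e \<and>\<^sub>g e') T"
| "nf_under e (PSeq (PInt bs) T) =
     nf_under e (PInt (map (\<lambda>b. Br (bguard b) (bchan b) (bsort b) (PSeq (bcont b) T)) bs))"
| "nf_under e (PSeq (PExt bs) T) =
     nf_under e (PExt (map (\<lambda>b. Br (bguard b) (bchan b) (bsort b) (PSeq (bcont b) T)) bs))"
| "nf_under e (PSeq (PSeq T T') T'') = nf_under e (PSeq T (PSeq T' T''))"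
| "nf_under e (PSeq (PStar T) T') =
     (case nf_under e T of
        PEnd e' \<Rightarrow> PEnd e'
      | _ \<Rightarrow> PSeq (nf_under e (PStar T)) (nf_under e T'))"
| "nf_under e (PStar T) =
     (case nf_under e T of PEnd e' \<Rightarrow> PEnd e' | N \<Rightarrow> PStar N)"
  by pat_completeness auto
termination
  by (relation "measure (\<lambda>(e, T). weight T)")
     (auto simp: weight_branch weight_pos weight_star less_SucI o_def weight_distrib algebra_simps
           simp flip: mult_Suc_right)

definition nf :: "('b, 'd) pty \<Rightarrow> ('b, 'd) pty" where
  "nf T = nf_under gtrue T"

definition normal :: "('b, 'd) pty \<Rightarrow> bool" where
  "normal T \<longleftrightarrow> nf T = T"


subsection \<open>Merge and guard erasure\<close>

text \<open>
  \<open>merge0 T T' M\<close> states that \<open>T\<close> and \<open>T'\<close> are mergeable, with merge \<open>M\<close>; \<open>merge0_brs\<close> does so for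
  branches that agree on channels and sorts, index by index.
\<close>

inductive merge0 :: "('b, 'd) pty \<Rightarrow> ('b, 'd) pty \<Rightarrow> ('b, 'd) pty \<Rightarrow> bool"
  and merge0_brs :: "('b, 'd) pbranch list \<Rightarrow> ('b, 'd) pbranch list \<Rightarrow> ('b, 'd) pbranch list \<Rightarrow> bool"
where
  "merge0_brs [] [] []"
| "merge0 T T' M \<Longrightarrow> e \<and>\<^sub>g e' = gfalse \<Longrightarrow> merge0_brs bs bs' cs \<Longrightarrow>
     merge0_brs (Br e y d T # bs) (Br e' y d T' # bs') (Br (e \<or>\<^sub>g e') y d M # cs)"
| "merge0 (PEnd g) (PEnd g') (PEnd (g \<or>\<^sub>g g'))"
| "mset as = mset bs \<Longrightarrow> mset as' = mset bs' \<Longrightarrow> merge0_brs bs bs' cs \<Longrightarrow>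
     merge0 (PExt as) (PExt as') (PExt cs)"
| "mset as = mset (bs @ js) \<Longrightarrow> mset as' = mset (bs' @ ks) \<Longrightarrow> merge0_brs bs bs' cs \<Longrightarrow>
     bchans bs \<inter> bchans js = {} \<Longrightarrow> bchans bs \<inter> bchans ks = {} \<Longrightarrow> bchans js \<inter> bchans ks = {} \<Longrightarrow>
     merge0 (PInt as) (PInt as') (PInt (cs @ js @ ks))"
| "merge0 T1 T2 M \<Longrightarrow> merge0 T1' T2' M' \<Longrightarrow> merge0 (PSeq T1 T1') (PSeq T2 T2') (PSeq M M')"
| "merge0 T1 T2 M \<Longrightarrow> merge0 (PStar T1) (PStar T2) (PStar M)"

definition merge :: "('b, 'd) pty \<Rightarrow> ('b, 'd) pty \<Rightarrow> ('b, 'd) pty \<Rightarrow> bool" where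
  "merge T T' M \<longleftrightarrow> normal T \<and> normal T' \<and> merge0 T T' M"

inductive merge_list :: "('b, 'd) pty list \<Rightarrow> ('b, 'd) pty \<Rightarrow> bool" where
  "merge_list [T] T"
| "merge T T' M \<Longrightarrow> merge_list (M # Ts) N \<Longrightarrow> merge_list (T # T' # Ts) N"

text \<open>
  Guard erasure is partial, as merge is.  A branch \<open>c\<close> of the result stands for the class of the
  branches of \<open>bs\<close> on the channel of \<open>c\<close>.
\<close>

inductive er :: "('b, 'd) pty \<Rightarrow> ('b, 'd) pty \<Rightarrow> bool" where
  "er (PEnd e) (PEnd gtrue)"
| "er T L \<Longrightarrow> er T' L' \<Longrightarrow> er (PSeq T T') (PSeq L L')"
| "er T L \<Longrightarrow> er (PStar T) (PStar L)"
| "distinct (map bchan cs) \<Longrightarrow> bchans cs = bchans bs \<Longrightarrow>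
   \<forall>c\<in>set cs. bguard c = gtrue \<and>
     (\<forall>b\<in>set bs. bchan b = bchan c \<longrightarrow> bsort b = bsort c) \<and>
     (\<exists>M. merge_list (map bcont (filter (\<lambda>b. bchan b = bchan c) bs)) M \<and> er M (bcont c)) \<Longrightarrow>
   er (PExt bs) (PExt cs)"
| "distinct (map bchan cs) \<Longrightarrow> bchans cs = bchans bs \<Longrightarrow>
   \<forall>c\<in>set cs. bguard c = gtrue \<and>
     (\<forall>b\<in>set bs. bchan b = bchan c \<longrightarrow> bsort b = bsort c) \<and>
     (\<exists>M. merge_list (map bcont (filter (\<lambda>b. bchan b = bchan c) bs)) M \<and> er M (bcont c)) \<Longrightarrow>
   er (PInt bs) (PInt cs)"


subsection \<open>Projection\<close>

abbreviation LEnd :: "('b, 'd) pty" where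
  "LEnd \<equiv> PEnd gtrue"

text \<open>
  The n-ary sum of local types.  Summands equal to the unit \<open>LEnd\<close> are dropped; the sum of several
  remaining ones is a local type only if they are external choices over distinct channels, possibly
  after distributing them over a sequential composition.
\<close>

definition local_sum :: "('b, 'd) pty list \<Rightarrow> ('b, 'd) pty \<Rightarrow> bool" where
  "local_sum Ts S \<longleftrightarrow>
     (let Us = filter (\<lambda>T. nf T \<noteq> LEnd) Ts in
        (Us = [] \<and> S = LEnd) \<or> Us = [S] \<or>
        (length Us \<ge> 2 \<and>
         (\<exists>bss. length bss = length Us \<and> (\<forall>i<length Us. nf (Us ! i) = PExt (bss ! i)) \<and>
            distinct (map bchan (concat bss)) \<and> S = PExt (concat bss))))"

text \<open>
  Projection is partial, because sums and local types are; it is a relation, because the order of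
  the outputs that terminate an iteration is not determined.
\<close>

inductive proj :: "'d gty \<Rightarrow> participant \<Rightarrow> ('b, 'd) pty \<Rightarrow> bool" where
  proj_absent: "r \<notin> gparts G \<Longrightarrow> proj G r LEnd"
| proj_select:
    "r \<in> gparts (GChoice r bs) \<Longrightarrow> length Ls = length bs \<Longrightarrow>
     \<forall>i<length bs. proj (gcont (bs ! i)) r (Ls ! i) \<Longrightarrow>
     distinct (map gchan bs) \<Longrightarrow>
     proj (GChoice r bs) r (PInt (map2 (\<lambda>b L. Br gtrue (gchan b) (gsort b) L) bs Ls))"
| proj_branch:
    "r \<in> gparts (GChoice p bs) \<Longrightarrow> r \<noteq> p \<Longrightarrow> length Ls = length bs \<Longrightarrow>
     \<forall>i<length bs. proj (gcont (bs ! i)) r (Ls ! i) \<Longrightarrow>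
     local_sum (map2 (\<lambda>b L. if grecv b = r then PExt [Br gtrue (gchan b) (gsort b) L] else L) bs Ls) S \<Longrightarrow>
     proj (GChoice p bs) r S"
| proj_seq:
    "r \<in> gparts (GSeq G G') \<Longrightarrow> proj G r L \<Longrightarrow> proj G' r L' \<Longrightarrow> proj (GSeq G G') r (PSeq L L')"
| proj_iter_rdy:
    "r \<in> gparts G \<Longrightarrow> r \<in> rdy G \<Longrightarrow> proj G r L \<Longrightarrow> distinct sgs \<Longrightarrow> set sgs = ran f \<Longrightarrow>
     proj (GIter G f) r
       (PSeq (PStar L) (foldr (\<lambda>(b, d) T. PSeq (PInt [Br gtrue b d LEnd]) T) sgs LEnd))"
| proj_iter:
    "r \<in> gparts G \<Longrightarrow> f r = Some (b, d) \<Longrightarrow> proj G r L \<Longrightarrow>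
     proj (GIter G f) r (PSeq (PStar L) (PExt [Br gtrue b d LEnd]))"

text \<open>\<open>er T = nf (G \<upharpoonright> p)\<close>\<close>

definition implements :: "('b, 'd) pty \<Rightarrow> 'd gty \<Rightarrow> participant \<Rightarrow> bool" where
  "implements T G p \<longleftrightarrow> (\<exists>E L. er T E \<and> proj G p L \<and> leq E (nf L))"


section \<open>Specifications\<close>

record ('b, 'd) spec =
  shared :: "sname \<rightharpoonup> 'd gdecl"
  sess :: "chan list \<times> participant \<rightharpoonup> ('b, 'd) pty"
  queue :: "chan \<rightharpoonup> 'd list"

definition is_spec :: "('b, 'd) spec \<Rightarrow> bool" where
  "is_spec \<Delta> \<longleftrightarrow>
     finite (dom (shared \<Delta>)) \<and> finite (dom (sess \<Delta>)) \<and> finite (dom (queue \<Delta>)) \<and>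
     (\<forall>u D. shared \<Delta> u = Some D \<longrightarrow> gdecl_wf D) \<and>
     (\<forall>ys p T. sess \<Delta> (ys, p) = Some T \<longrightarrow>
        distinct ys \<and> psyntax T \<and> pchans T \<subseteq> set ys) \<and>
     (\<forall>ys p ys' p'. (ys, p) \<in> dom (sess \<Delta>) \<and> (ys', p') \<in> dom (sess \<Delta>) \<longrightarrow>
        ys = ys' \<or> set ys \<inter> set ys' = {})"

definition normal_types :: "('b, 'd) spec \<Rightarrow> bool" where
  "normal_types \<Delta> \<longleftrightarrow> (\<forall>T\<in>ran (sess \<Delta>). normal T)"

definition nf_spec :: "('b, 'd) spec \<Rightarrow> ('b, 'd) spec" where
  "nf_spec \<Delta> = \<Delta>\<lparr>sess := (\<lambda>s. map_option nf (sess \<Delta> s))\<rparr>"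

definition end_only :: "('b, 'd) spec \<Rightarrow> bool" where
  "end_only \<Delta> \<longleftrightarrow> (\<forall>T\<in>ran (sess \<Delta>). \<exists>e. nf T = PEnd e)"

text \<open>
  \<open>seq_defined\<close> is the definedness condition of \<open>\<Delta>\<^sub>1;\<Delta>\<^sub>2\<close>.  Since specifications are
  kept in normal form, the two compositions normalise their result.
\<close>

definition seq_defined :: "('b, 'd) spec \<Rightarrow> ('b, 'd) spec \<Rightarrow> bool" where
  "seq_defined \<Delta>\<^sub>1 \<Delta>\<^sub>2 \<longleftrightarrow>
     dom (sess \<Delta>\<^sub>2) \<subseteq> dom (sess \<Delta>\<^sub>1) \<and> shared \<Delta>\<^sub>1 = shared \<Delta>\<^sub>2 \<and> queue \<Delta>\<^sub>1 = queue \<Delta>\<^sub>2"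

definition spec_seq :: "('b, 'd) spec \<Rightarrow> ('b, 'd) spec \<Rightarrow> ('b, 'd) spec" where
  "spec_seq \<Delta>\<^sub>1 \<Delta>\<^sub>2 =
     nf_spec (\<Delta>\<^sub>1\<lparr>sess := (\<lambda>s. case (sess \<Delta>\<^sub>1 s, sess \<Delta>\<^sub>2 s) of
                              (Some T\<^sub>1, Some T\<^sub>2) \<Rightarrow> Some (PSeq T\<^sub>1 T\<^sub>2)
                            | (T, _) \<Rightarrow> T)\<rparr>)"

definition spec_star :: "('b, 'd) spec \<Rightarrow> ('b, 'd) spec" where
  "spec_star \<Delta> = nf_spec (\<Delta>\<lparr>sess := (\<lambda>s. map_option PStar (sess \<Delta> s))\<rparr>)"


section \<open>Transitions\<close>

datatype 'd label =
    Tau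
  | LReq sname nat "chan list"
  | LAcc sname participant "chan list"
  | LOut chan 'd
  | LIn chan 'd

text \<open>
  \<open>step\<close> relates specifications with types in normal form; each rule normalises its target.
  In \<open>TReq\<close>, \<open>TAcc\<close> and \<open>TInit\<close> the comma is extension with disjoint domain
  that yields an element of \<open>is_spec\<close> again.
\<close>

inductive step :: "('b, 'd) spec \<Rightarrow> 'd label \<Rightarrow> ('b, 'd) spec \<Rightarrow> bool" where
  TReq:
    "\<lbrakk>is_spec \<Delta>; normal_types \<Delta>;
      shared \<Delta> u = Some D; gdecl_eq D (ys, G); implements T G 0;
      (ys, 0) \<notin> dom (sess \<Delta>); \<Delta>' = \<Delta>\<lparr>sess := (sess \<Delta>)((ys, 0) \<mapsto> T)\<rparr>; is_spec \<Delta>'\<rbrakk>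
     \<Longrightarrow> step \<Delta> (LReq u n ys) (nf_spec \<Delta>')"
| TAcc:
    "\<lbrakk>is_spec \<Delta>; normal_types \<Delta>;
      shared \<Delta> u = Some D; gdecl_eq D (ys, G); implements T G p;
      (ys, p) \<notin> dom (sess \<Delta>); \<Delta>' = \<Delta>\<lparr>sess := (sess \<Delta>)((ys, p) \<mapsto> T)\<rparr>; is_spec \<Delta>'\<rbrakk>
     \<Longrightarrow> step \<Delta> (LAcc u p ys) (nf_spec \<Delta>')"
| TRcv:
    "\<lbrakk>is_spec \<Delta>; normal_types \<Delta>;
      sess \<Delta> (ys, p) = Some (PExt bs); Br e y d T \<in> set bs\<rbrakk>
     \<Longrightarrow> step \<Delta> (LIn y d) (nf_spec (\<Delta>\<lparr>sess := (sess \<Delta>)((ys, p) \<mapsto> T)\<rparr>))"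
| TSend:
    "\<lbrakk>is_spec \<Delta>; normal_types \<Delta>;
      sess \<Delta> (ys, p) = Some (PInt bs); Br e y d T \<in> set bs\<rbrakk>
     \<Longrightarrow> step \<Delta> (LOut y d) (nf_spec (\<Delta>\<lparr>sess := (sess \<Delta>)((ys, p) \<mapsto> T)\<rparr>))"
| TSeq:
    "\<lbrakk>is_spec \<Delta>\<^sub>1; normal_types \<Delta>\<^sub>1; is_spec \<Delta>\<^sub>2; normal_types \<Delta>\<^sub>2;
      seq_defined \<Delta>\<^sub>1 \<Delta>\<^sub>2; step \<Delta>\<^sub>1 \<alpha> \<Delta>\<^sub>1'; seq_defined \<Delta>\<^sub>1' \<Delta>\<^sub>2\<rbrakk>
     \<Longrightarrow> step (spec_seq \<Delta>\<^sub>1 \<Delta>\<^sub>2) \<alpha> (spec_seq \<Delta>\<^sub>1' \<Delta>\<^sub>2)"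
| TLoop0:
    "\<lbrakk>is_spec \<Delta>\<^sub>1; normal_types \<Delta>\<^sub>1; is_spec \<Delta>\<^sub>2; normal_types \<Delta>\<^sub>2;
      seq_defined (spec_star \<Delta>\<^sub>1) \<Delta>\<^sub>2; step \<Delta>\<^sub>2 (LIn y d) \<Delta>\<^sub>2'\<rbrakk>
     \<Longrightarrow> step (spec_seq (spec_star \<Delta>\<^sub>1) \<Delta>\<^sub>2) (LIn y d) \<Delta>\<^sub>2'"
| TLoop1:
    "\<lbrakk>is_spec \<Delta>; normal_types \<Delta>; step \<Delta> \<alpha> \<Delta>'\<rbrakk>
     \<Longrightarrow> step (spec_star \<Delta>) \<alpha> \<Delta>'"
| TLoop2:
    "\<lbrakk>is_spec \<Delta>; normal_types \<Delta>; step \<Delta> \<alpha> \<Delta>'; seq_defined \<Delta>' (spec_star \<Delta>)\<rbrakk>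
     \<Longrightarrow> step (spec_star \<Delta>) \<alpha> (spec_seq \<Delta>' (spec_star \<Delta>))"
| TInit:
    "\<lbrakk>is_spec \<Delta>; normal_types \<Delta>;
      shared \<Delta> u = Some D; gdecl_eq D (ys, G); gparts G \<noteq> {};
      \<forall>p\<in>gparts G. implements (T p) G p;
      \<forall>p\<in>gparts G. (ys, p) \<notin> dom (sess \<Delta>); set ys \<inter> dom (queue \<Delta>) = {};
      \<Delta>' = \<Delta>\<lparr>sess := (\<lambda>(zs, p). if zs = ys \<and> p \<in> gparts G then Some (T p) else sess \<Delta> (zs, p)),
              queue := (\<lambda>y. if y \<in> set ys then Some [] else queue \<Delta> y)\<rparr>;
      is_spec \<Delta>'\<rbrakk>
     \<Longrightarrow> step \<Delta> Tau (nf_spec \<Delta>')"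
| TCom1:
    "\<lbrakk>is_spec \<Delta>; normal_types \<Delta>;
      sess \<Delta> (ys, p) = Some (PInt bs); Br e y d T \<in> set bs; queue \<Delta> y = Some ds\<rbrakk>
     \<Longrightarrow> step \<Delta> Tau (nf_spec (\<Delta>\<lparr>sess := (sess \<Delta>)((ys, p) \<mapsto> T),
                                queue := (queue \<Delta>)(y \<mapsto> ds @ [d])\<rparr>))"
| TCom2:
    "\<lbrakk>is_spec \<Delta>; normal_types \<Delta>;
      sess \<Delta> (ys, p) = Some (PExt bs); Br e y d T \<in> set bs; queue \<Delta> y = Some (d # ds)\<rbrakk>
     \<Longrightarrow> step \<Delta> Tau (nf_spec (\<Delta>\<lparr>sess := (sess \<Delta>)((ys, p) \<mapsto> T),
                                queue := (queue \<Delta>)(y \<mapsto> ds)\<rparr>))"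

definition transition :: "('b, 'd) spec \<Rightarrow> 'd label \<Rightarrow> ('b, 'd) spec \<Rightarrow> bool"
    ("(_/ \<midarrow>_\<rightarrow> _)" [51, 0, 51] 50) where
  "\<Delta> \<midarrow>\<alpha>\<rightarrow> \<Delta>' \<longleftrightarrow> step (nf_spec \<Delta>) \<alpha> \<Delta>'"


section \<open>Runs\<close>

datatype 'd event = EOut participant chan 'd | EIn participant chan 'd

datatype 'd titem = Ev "'d event" | Opt "'d titem list"

type_synonym 'd trace = "'d titem list"

fun event_part :: "'d event \<Rightarrow> participant" where
  "event_part (EOut p y d) = p"
| "event_part (EIn p y d) = p"

fun event_chan :: "'d event \<Rightarrow> chan" where
  "event_chan (EOut p y d) = y"
| "event_chan (EIn p y d) = y"

inductive trace_eq :: "'d trace \<Rightarrow> 'd trace \<Rightarrow> bool" where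
  "trace_eq r r"
| "trace_eq r r' \<Longrightarrow> trace_eq r' r"
| "trace_eq r r' \<Longrightarrow> trace_eq r' r'' \<Longrightarrow> trace_eq r r''"
| "event_part a \<noteq> event_part b \<Longrightarrow> event_chan a \<noteq> event_chan b \<Longrightarrow>
     trace_eq (u @ Ev a # Ev b # v) (u @ Ev b # Ev a # v)"
| "trace_eq r r' \<Longrightarrow> trace_eq (u @ Opt r # v) (u @ Opt r' # v)"

text \<open>
  A set of equivalence classes of traces is represented by its union, which is closed under
  \<open>trace_eq\<close> (rule \<open>RTPerm\<close>).
\<close>

inductive runs_rule :: "chan list \<Rightarrow> ('b, 'd) spec \<Rightarrow> 'd trace \<Rightarrow> bool" for ys where
  RTEnd:
    "\<lbrakk>is_spec \<Delta>; normal_types \<Delta>; end_only \<Delta>; \<forall>y\<in>set ys. queue \<Delta> y = Some []\<rbrakk>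
     \<Longrightarrow> runs_rule ys \<Delta> []"
| RTCom1:
    "\<lbrakk>is_spec \<Delta>; normal_types \<Delta>;
      sess \<Delta> (ys, p) = Some (PInt bs); Br e y d T \<in> set bs; queue \<Delta> y = Some ds;
      runs_rule ys (nf_spec (\<Delta>\<lparr>sess := (sess \<Delta>)((ys, p) \<mapsto> T),
                                queue := (queue \<Delta>)(y \<mapsto> ds @ [d])\<rparr>)) r\<rbrakk>
     \<Longrightarrow> runs_rule ys \<Delta> (Ev (EOut p y d) # r)"
| RTCom2:
    "\<lbrakk>is_spec \<Delta>; normal_types \<Delta>;
      sess \<Delta> (ys, p) = Some (PExt bs); Br e y d T \<in> set bs; queue \<Delta> y = Some (d # ds);
      runs_rule ys (nf_spec (\<Delta>\<lparr>sess := (sess \<Delta>)((ys, p) \<mapsto> T),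
                                queue := (queue \<Delta>)(y \<mapsto> ds)\<rparr>)) r\<rbrakk>
     \<Longrightarrow> runs_rule ys \<Delta> (Ev (EIn p y d) # r)"
| RTIt1:
    "runs_rule ys \<Delta> r \<Longrightarrow> runs_rule ys (spec_star \<Delta>) r"
| RTIt2:
    "\<lbrakk>runs_rule ys \<Delta> r\<^sub>1; runs_rule ys (spec_star \<Delta>) r\<^sub>2\<rbrakk>
     \<Longrightarrow> runs_rule ys (spec_star \<Delta>) (r\<^sub>1 @ [Opt r\<^sub>2])"
| RTSeq:
    "\<lbrakk>seq_defined \<Delta>\<^sub>1 \<Delta>\<^sub>2; runs_rule ys \<Delta>\<^sub>1 r\<^sub>1; runs_rule ys \<Delta>\<^sub>2 r\<^sub>2\<rbrakk>
     \<Longrightarrow> runs_rule ys (spec_seq \<Delta>\<^sub>1 \<Delta>\<^sub>2) (r\<^sub>1 @ r\<^sub>2)"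
| RTPerm:
    "runs_rule ys \<Delta> r \<Longrightarrow> trace_eq r r' \<Longrightarrow> runs_rule ys \<Delta> r'"

text \<open>
  The runs of session \<open>ys\<close> concern the entries of \<open>\<Delta>\<close> for session \<open>ys\<close> only: the side condition
  \<open>end_only\<close> and the operations in the rules refer to the participants of \<open>ys\<close>, and other sessions
  need not be terminated (or iterated in lockstep) for a run of \<open>ys\<close> to be complete.
\<close>

definition session_part :: "chan list \<Rightarrow> ('b, 'd) spec \<Rightarrow> ('b, 'd) spec" where
  "session_part ys \<Delta> =
     \<lparr>shared = Map.empty,
      sess = (\<lambda>(zs, p). if zs = ys then sess \<Delta> (zs, p) else None),
      queue = queue \<Delta> |` set ys\<rparr>"

definition runs :: "chan list \<Rightarrow> ('b, 'd) spec \<Rightarrow> 'd trace set" where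
  "runs ys \<Delta> = {r. runs_rule ys (session_part ys \<Delta>) r}"

text \<open>
  \<open>ys\<close> is a session running in \<open>\<Delta>\<close>: its queues exist, and \<open>ys\<close> obeys the convention that session
  tuples are equal or disjoint.  If a queue of \<open>ys\<close> is missing, the session has not been initiated
  in \<open>\<Delta>\<close> and \<open>runs ys \<Delta>\<close> is empty.
\<close>

definition session_of :: "('b, 'd) spec \<Rightarrow> chan list \<Rightarrow> bool" where
  "session_of \<Delta> ys \<longleftrightarrow> set ys \<subseteq> dom (queue \<Delta>) \<and>
     (\<forall>zs p. (zs, p) \<in> dom (sess \<Delta>) \<longrightarrow> zs = ys \<or> set zs \<inter> set ys = {})"

end

theory Submission
  imports Defs
begin

text \<open>
  Every silent transition changes some queue, whereas \<open>seq_defined\<close> forces the two components of a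
  sequential composition to have the same queues, before and after the transition.  Hence a silent
  transition never uses \<open>TSeq\<close> or \<open>TLoop2\<close>: it is a session initiation or a communication below a
  stack of \<open>TLoop1\<close>.  An initiation concerns fresh channels only, a communication in another session
  does not touch \<open>ys\<close>, a communication in \<open>ys\<close> is undone by \<open>RTCom1\<close> or \<open>RTCom2\<close>, and \<open>TLoop1\<close>
  is undone by \<open>RTIt1\<close>.
\<close>

lemma gparts_grename [simp]: "gparts (grename h G) = gparts G"
  by (induction h G rule: grename.induct) auto

lemma geq_gparts: "geq G G' \<Longrightarrow> gparts G = gparts G'"
  by (induction rule: geq.induct) (auto dest: mset_eq_setD)

lemma gparts_empty: "gchans G = {} \<Longrightarrow> gparts G = {}"
  by (induction G rule: gparts.induct) auto

text \<open>Every interaction carries a channel, every channel is a parameter, and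
  \<open>gdecl_eq\<close> preserves participants. Hence a session initiation creates at least one
  queue.\<close>

lemma gdecl_params_nonempty:
  assumes "gdecl_wf D" "gdecl_eq D (ys, G)" "gparts G \<noteq> {}"
  shows "ys \<noteq> []"
proof
  assume "ys = []"
  with assms(2) have "fst D = []"
    by (auto simp: gdecl_eq_def)
  with assms(1) have "gparts (snd D) = {}"
    by (intro gparts_empty) (auto simp: gdecl_wf_def)
  moreover have "gparts (snd D) = gparts G"
    using assms(2) by (auto simp: gdecl_eq_def dest: geq_gparts)
  ultimately show False
    using assms(3) by simp
qed

lemma is_spec_gdecl_wf: "is_spec \<Delta> \<Longrightarrow> shared \<Delta> u = Some D \<Longrightarrow> gdecl_wf D"
  unfolding is_spec_def by blast

lemma is_spec_pchans: "is_spec \<Delta> \<Longrightarrow> sess \<Delta> (ys, p) = Some T \<Longrightarrow> pchans T \<subseteq> set ys"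
  unfolding is_spec_def by blast

lemma queue_nf_spec [simp]: "queue (nf_spec \<Delta>) = queue \<Delta>"
  and sess_nf_spec [simp]: "sess (nf_spec \<Delta>) = (\<lambda>s. map_option nf (sess \<Delta> s))"
  and queue_spec_star [simp]: "queue (spec_star \<Delta>) = queue \<Delta>"
  and queue_spec_seq [simp]: "queue (spec_seq \<Delta> \<Delta>\<^sub>2) = queue \<Delta>"
  by (simp_all add: nf_spec_def spec_star_def spec_seq_def)

lemma sess_spec_star [simp]: "sess (spec_star \<Delta>) = (\<lambda>s. map_option (\<lambda>T. nf (PStar T)) (sess \<Delta> s))"
  by (simp add: spec_star_def option.map_comp o_def)

lemma session_of_spec_star [simp]: "session_of (spec_star \<Delta>) ys = session_of \<Delta> ys"
  by (simp add: session_of_def dom_def)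

lemma nf_spec_normal: "normal_types \<Delta> \<Longrightarrow> nf_spec \<Delta> = \<Delta>"
  by (rule spec.equality)
    (auto simp: nf_spec_def normal_types_def normal_def ran_def fun_eq_iff map_option_case
      split: option.split)

lemma session_part_nf_spec: "session_part ys (nf_spec \<Delta>) = nf_spec (session_part ys \<Delta>)"
  by (auto simp: session_part_def nf_spec_def fun_eq_iff)

lemma session_part_spec_star: "session_part ys (spec_star \<Delta>) = spec_star (session_part ys \<Delta>)"
  by (auto simp: session_part_def spec_star_def nf_spec_def fun_eq_iff)

lemma session_part_cong:
  assumes "\<And>p. sess \<Delta>' (ys, p) = sess \<Delta> (ys, p)" "\<And>y. y \<in> set ys \<Longrightarrow> queue \<Delta>' y = queue \<Delta> y"
  shows "session_part ys \<Delta>' = session_part ys \<Delta>"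
  using assms by (auto simp: session_part_def restrict_map_def fun_eq_iff)

lemma is_spec_session_part:
  assumes "is_spec \<Delta>"
  shows "is_spec (session_part ys \<Delta>)"
proof -
  have "dom (sess (session_part ys \<Delta>)) \<subseteq> dom (sess \<Delta>)"
    by (auto simp: session_part_def split: if_splits)
  moreover have "finite (dom (sess \<Delta>))"
    using assms by (simp add: is_spec_def)
  ultimately have "finite (dom (sess (session_part ys \<Delta>)))"
    by (rule finite_subset)
  then show ?thesis
    using assms by (auto simp: is_spec_def session_part_def split: if_splits)
qed

lemma normal_types_session_part: "normal_types \<Delta> \<Longrightarrow> normal_types (session_part ys \<Delta>)"
  by (auto simp: normal_types_def session_part_def ran_def split: if_splits)

text \<open>\<open>nf_spec\<close> acts on all sessions, but on the untouched types of
  \<open>ys\<close> it is the identity, as these are already normal.\<close>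

lemma session_part_nf_spec_other:
  assumes "normal_types \<Delta>"
    and "\<And>p. sess \<Delta>' (ys, p) = sess \<Delta> (ys, p)" "\<And>y. y \<in> set ys \<Longrightarrow> queue \<Delta>' y = queue \<Delta> y"
  shows "session_part ys (nf_spec \<Delta>') = session_part ys \<Delta>"
  using session_part_cong[OF assms(2,3)] nf_spec_normal[OF normal_types_session_part[OF assms(1)]]
  by (simp add: session_part_nf_spec)

text \<open>Matches the target of a communication in \<open>ys\<close> with the premises of
  \<open>RTCom1\<close> and \<open>RTCom2\<close>, which here concern the restricted
  specification.\<close>

lemma session_part_update:
  "y \<in> set ys \<Longrightarrow>
    session_part ys (\<Delta>\<lparr>sess := (sess \<Delta>)((ys, p) \<mapsto> T), queue := (queue \<Delta>)(y \<mapsto> ds)\<rparr>) =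
    (session_part ys \<Delta>)\<lparr>sess := (sess (session_part ys \<Delta>))((ys, p) \<mapsto> T),
      queue := (queue (session_part ys \<Delta>))(y \<mapsto> ds)\<rparr>"
  by (auto simp: session_part_def restrict_map_def fun_eq_iff)

text \<open>By \<open>session_of\<close>, the distinct tuples \<open>zs\<close> and
  \<open>ys\<close> share no channel, so the updated queue lies outside \<open>ys\<close>.\<close>

lemma session_part_update_other:
  assumes "normal_types \<Delta>" "session_of \<Delta> ys" "zs \<noteq> ys" "sess \<Delta> (zs, p) = Some T" "y \<in> set zs"
  shows "session_part ys (nf_spec (\<Delta>\<lparr>sess := (sess \<Delta>)((zs, p) \<mapsto> T'),
      queue := (queue \<Delta>)(y \<mapsto> ds)\<rparr>)) = session_part ys \<Delta>"
  using assms by (intro session_part_nf_spec_other) (auto simp: session_of_def)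

text \<open>\<open>TInit\<close> creates an absent queue, and \<open>TCom1\<close> and
  \<open>TCom2\<close> change the length of one. \<open>spec_star\<close> keeps the queues of its
  body and \<open>spec_seq\<close> those of its first component, so the change persists.\<close>

lemma step_Tau_queue: "step \<Delta> \<alpha> \<Delta>' \<Longrightarrow> \<alpha> = Tau \<Longrightarrow> queue \<Delta>' \<noteq> queue \<Delta>"
proof (induction rule: step.induct)
  case (TInit \<Delta> u D ys G T \<Delta>')
  then have "gdecl_wf D"
    by (auto dest: is_spec_gdecl_wf)
  then have "ys \<noteq> []"
    using TInit(4,5) by (rule gdecl_params_nonempty)
  then obtain y where "y \<in> set ys"
    by (cases ys) auto
  then have "queue \<Delta> y = None" "queue \<Delta>' y = Some []"
    using TInit by auto
  then show ?case
    by auto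
qed (auto simp: seq_defined_def fun_upd_idem_iff)

theorem lemma8p5:
  fixes \<Delta> \<Delta>' :: "('b, 'd) spec" and ys :: "chan list"
  assumes "is_spec \<Delta>"
    and "\<forall>s\<in>dom (sess \<Delta>). normal (the (sess \<Delta> s))"
    and "distinct ys"
    and "session_of \<Delta> ys"
    and "\<Delta> \<midarrow>Tau\<rightarrow> \<Delta>'"
  shows "\<forall>r\<in>runs ys \<Delta>'.
    r \<in> runs ys \<Delta> \<or>
    (\<exists>p y d. Ev (EOut p y d) # r \<in> runs ys \<Delta>) \<or>
    (\<exists>q y d. Ev (EIn q y d) # r \<in> runs ys \<Delta>)"
proof
  fix r
  assume r: "r \<in> runs ys \<Delta>'"
  have "normal_types \<Delta>"
    using assms(2) by (force simp: normal_types_def ran_def)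
  then have "step \<Delta> Tau \<Delta>'"
    using assms(5) by (simp add: transition_def nf_spec_normal)
  then show "r \<in> runs ys \<Delta> \<or>
    (\<exists>p y d. Ev (EOut p y d) # r \<in> runs ys \<Delta>) \<or>
    (\<exists>q y d. Ev (EIn q y d) # r \<in> runs ys \<Delta>)"
    \<comment> \<open>Both facts vary with the specifications: under \<open>TLoop1\<close> the
      induction hypothesis speaks of the loop body.\<close>
    using assms(4) r
  proof (induction \<Delta> "Tau :: 'd label" \<Delta>' rule: step.induct)
    case (TSeq \<Delta>\<^sub>1 \<Delta>\<^sub>2 \<Delta>\<^sub>1')
    then show ?case
      using step_Tau_queue by (fastforce simp: seq_defined_def)
  next
    case (TLoop1 \<Delta> \<Delta>')
    \<comment> \<open>This inclusion lifts each of the three alternatives: a missing first event is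
      prepended within the body before \<open>RTIt1\<close> applies.\<close>
    have "runs ys \<Delta> \<subseteq> runs ys (spec_star \<Delta>)"
      by (auto simp: runs_def session_part_spec_star intro: RTIt1)
    with TLoop1 show ?case
      by (simp add: subset_iff) blast
  next
    case (TLoop2 \<Delta> \<Delta>')
    \<comment> \<open>Definedness equates the queues of \<open>\<Delta>'\<close> with those of
      \<open>spec_star \<Delta>\<close>, hence of \<open>\<Delta>\<close>.\<close>
    then show ?case
      using step_Tau_queue by (fastforce simp: seq_defined_def)
  next
    case (TInit \<Delta> u D zs G T \<Delta>')
    then have "gdecl_wf D"
      by (auto dest: is_spec_gdecl_wf)
    then have "zs \<noteq> []"
      using TInit(4,5) by (rule gdecl_params_nonempty)
    \<comment> \<open>The queues of \<open>ys\<close> already exist, whereas the channels of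
      \<open>zs\<close> are fresh.\<close>
    moreover have disjoint: "set zs \<inter> set ys = {}"
      using TInit by (auto simp: session_of_def)
    ultimately have "zs \<noteq> ys"
      by auto
    then have "session_part ys (nf_spec \<Delta>') = session_part ys \<Delta>"
      using TInit disjoint by (intro session_part_nf_spec_other) auto
    then show ?case
      using TInit by (simp add: runs_def)
  next
    case (TCom1 \<Delta> zs p bs e y d T ds)
    \<comment> \<open>A pseudo-type of session \<open>zs\<close> uses only channels of
      \<open>zs\<close>.\<close>
    then have y: "y \<in> set zs"
      using is_spec_pchans[OF TCom1(1,3)] by force
    show ?case
    proof (cases "zs = ys")
      case True
      \<comment> \<open>The missing event is the output just performed.\<close>
      then have "runs_rule ys (session_part ys \<Delta>) (Ev (EOut p y d) # r)"
        using TCom1 y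
        by (intro RTCom1[where T = T and e = e and bs = bs and ds = ds])
          (auto simp: is_spec_session_part normal_types_session_part runs_def
            session_part_nf_spec session_part_update, auto simp: session_part_def)
      then show ?thesis
        by (auto simp: runs_def)
    next
      case False
      then show ?thesis
        using TCom1 y by (simp add: runs_def session_part_update_other)
    qed
  next
    case (TCom2 \<Delta> zs p bs e y d T ds)
    then have y: "y \<in> set zs"
      using is_spec_pchans[OF TCom2(1,3)] by force
    show ?case
    proof (cases "zs = ys")
      case True
      then have "runs_rule ys (session_part ys \<Delta>) (Ev (EIn p y d) # r)"
        using TCom2 y
        by (intro RTCom2[where T = T and e = e and bs = bs and ds = ds])
          (auto simp: is_spec_session_part normal_types_session_part runs_def
            session_part_nf_spec session_part_update, auto simp: session_part_def)
      then show ?thesis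
        by (auto simp: runs_def)
    next
      case False
      then show ?thesis
        using TCom2 y by (simp add: runs_def session_part_update_other)
    qed
  qed
qed

end
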